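(* Let $V=\{1,\dots,n\}$ and let $\mathcal{W}\subseteq\mathbb{R}^{n\times n}$ be a set of symmetric weight matrices whose entries may be negative. Let $\mathrm{Val(RP)}=\tfrac12\max_{y\in\{-1,1\}^n}\min_{W\in\mathcal{W}}\sum_{i<j}w_{ij}(1-y_iy_j)$. Let $\hat Y$ be an optimal solution of $\max_{Y\succeq0,\,Y_{ii}=1}\min_{W\in\mathcal{W}}\frac14\langle W,\mathbf{1}-Y\rangle$ ($\mathbf{1}$ the all-ones matrix), let $\hat u_1,\dots,\hat u_n\in S_n$ be the columns of a factor $U$ with $\hat Y=U^TU$, draw $r$ uniformly from the unit sphere $S_n\subseteq\mathbb{R}^n$, and set $\hat y_i=1$ if $\hat u_i\cdot r\ge0$, $\hat y_i=-1$ otherwise. For $W\in\mathcal{W}$ let $\hat C(W)=\sum_{i<j}w_{ij}\frac{1-\hat y_i\hat y_j}{2}$ and $W_-=\sum_{i<j:\,w_{ij}<0}w_{ij}$. Then for all $W\in\mathcal{W}$, $$\mathbb{E}[\hat C(W)]-W_-\ \ge\ 0.878\,\big(\mathrm{Val(RP)}-W_-\big),$$ where the expectation is over $r$.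
   Context: Robust max-cut with arbitrary-sign edge weights and the Goemans–Williamson rounding algorithm. Standing assumptions: problems well-posed with finite optimal values, inner minima attained, expectations well-defined. *)

theory Defs
  imports "HOL-Probability.Probability"
begin

text \<open>
  The vertex set \<open>{1,\<dots>,n}\<close> is an arbitrary finite well-ordered (equivalently, finite linearly
  ordered) index type \<open>'n\<close>, with
  \<open>n = CARD('n)\<close>; the order only serves to write sums over pairs \<open>i < j\<close>.
\<close>

definition cut_value :: "real^'n::{finite,wellorder}^'n::{finite,wellorder} \<Rightarrow> real^'n::{finite,wellorder} \<Rightarrow> real" where
  "cut_value W y = (\<Sum>i\<in>UNIV. \<Sum>j | i < j. W $ i $ j * ((1 - y $ i * y $ j) / 2))"

definition neg_weight :: "real^'n::{finite,wellorder}^'n::{finite,wellorder} \<Rightarrow> real" where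
  "neg_weight W = (\<Sum>i\<in>UNIV. \<Sum>j | i < j \<and> W $ i $ j < 0. W $ i $ j)"

definition sign_vectors :: "(real^'n) set" where
  "sign_vectors = {y. \<forall>i. y $ i \<in> {-1, 1}}"

definition rp_objective :: "real^'n::{finite,wellorder}^'n::{finite,wellorder} \<Rightarrow> real^'n::{finite,wellorder} \<Rightarrow> real" where
  "rp_objective W y = (\<Sum>i\<in>UNIV. \<Sum>j | i < j. W $ i $ j * (1 - y $ i * y $ j))"

text \<open>
  The infimum is a minimum whenever \<open>rp_objective\<close> attains its minimum over \<open>\<W>\<close>
  (lemma \<open>INF_eq_attained_min\<close> below).
\<close>

definition rp_val :: "(real^'n::{finite,wellorder}^'n::{finite,wellorder}) set \<Rightarrow> real" where
  "rp_val \<W> = 1/2 * (MAX y\<in>sign_vectors. INF W\<in>\<W>. rp_objective W y)"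

definition pos_semidef :: "real^'n^'n \<Rightarrow> bool" where
  "pos_semidef A \<longleftrightarrow> transpose A = A \<and> (\<forall>x. 0 \<le> x \<bullet> (A *v x))"

definition sdp_feasible :: "real^'n^'n \<Rightarrow> bool" where
  "sdp_feasible Y \<longleftrightarrow> pos_semidef Y \<and> (\<forall>i. Y $ i $ i = 1)"

text \<open>
  On \<open>real^'n^'n\<close> the operation \<open>\<bullet>\<close> is the Frobenius inner product.
\<close>

definition sdp_objective :: "real^'n^'n \<Rightarrow> real^'n^'n \<Rightarrow> real" where
  "sdp_objective W Y = 1/4 * (W \<bullet> ((\<chi> i j. 1) - Y))"

definition inner_min_attained :: "('w \<Rightarrow> real) \<Rightarrow> 'w set \<Rightarrow> bool" where
  "inner_min_attained f \<W> \<longleftrightarrow> (\<exists>W. is_arg_min f (\<lambda>W. W \<in> \<W>) W)"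

definition gw_round :: "real^'n^'n \<Rightarrow> real^'n \<Rightarrow> real^'n" where
  "gw_round U r = (\<chi> i. if column i U \<bullet> r \<ge> 0 then 1 else -1)"

text \<open>
  The uniform distribution on the unit sphere: the radial projection of the uniform distribution
  on the unit ball. It is a Borel probability measure on the ambient space that is concentrated on
  the sphere and invariant under orthogonal transformations (lemmas below), which determines it.
\<close>

definition uniform_sphere :: "'a::euclidean_space measure" where
  "uniform_sphere = distr (uniform_measure lborel (ball 0 1)) borel sgn"

lemma finite_sign_vectors: "finite (sign_vectors :: (real^'n) set)"
proof -
  have "sign_vectors \<subseteq> vec_lambda ` (PiE (UNIV::'n set) (\<lambda>_. {-1, 1::real}))"
  proof
    fix y :: "real^'n" assume "y \<in> sign_vectors"
    then have "(\<lambda>i. y $ i) \<in> PiE UNIV (\<lambda>_. {-1, 1})"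
      by (auto simp: sign_vectors_def)
    then show "y \<in> vec_lambda ` (PiE UNIV (\<lambda>_. {-1, 1}))"
      by (metis image_eqI vec_nth_inverse)
  qed
  then show ?thesis
    by (rule finite_subset) (intro finite_imageI finite_PiE, auto)
qed

lemma INF_eq_attained_min:
  fixes f :: "'w \<Rightarrow> real"
  assumes "is_arg_min f (\<lambda>W. W \<in> \<W>) W"
  shows "(INF W\<in>\<W>. f W) = f W"
  using assms by (intro cInf_eq_minimum) (auto simp: is_arg_min_linorder)

lemma emeasure_unit_ball:
  "emeasure lborel (ball (0::'a::euclidean_space) 1) \<noteq> 0"
  "emeasure lborel (ball (0::'a::euclidean_space) 1) \<noteq> \<infinity>"
proof -
  have "measure lborel (ball (0::'a) 1) \<noteq> 0"
    using content_ball_pos[of 1 "0::'a"] by simp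
  then show "emeasure lborel (ball (0::'a) 1) \<noteq> 0"
    by (metis enn2real_0 measure_def)
  show "emeasure lborel (ball (0::'a) 1) \<noteq> \<infinity>"
    using emeasure_lborel_ball_finite[of "0::'a" 1] by (simp add: less_top)
qed

lemma sets_uniform_sphere [simp, measurable_cong]: "sets uniform_sphere = sets borel"
  by (simp add: uniform_sphere_def)

lemma prob_space_uniform_sphere: "prob_space (uniform_sphere :: 'a::euclidean_space measure)"
  unfolding uniform_sphere_def
  by (intro prob_space.prob_space_distr prob_space_uniform_measure emeasure_unit_ball) simp

lemma AE_uniform_sphere: "AE r in uniform_sphere. r \<in> sphere (0::'a::euclidean_space) 1"
proof -
  have m: "sgn \<in> uniform_measure lborel (ball (0::'a) 1) \<rightarrow>\<^sub>M borel" by simp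
  have "AE x in lborel. (x::'a) \<in> ball 0 1 \<longrightarrow> norm (sgn x) = 1"
    using AE_lborel_singleton[of "0::'a"] by eventually_elim (simp add: norm_sgn)
  then have "AE x in uniform_measure lborel (ball (0::'a) 1). norm (sgn x) = 1"
    by (intro AE_uniform_measureI) auto
  then show ?thesis
    unfolding uniform_sphere_def by (subst AE_distr_iff[OF m]) auto
qed

lemma distr_orthogonal_uniform_sphere:
  fixes T :: "real^'n::{finite,wellorder} \<Rightarrow> real^'n::{finite,wellorder}"
  assumes T: "orthogonal_transformation T"
  shows "distr uniform_sphere borel T = uniform_sphere"
proof (rule measure_eqI)
  have lin: "linear T" and surj: "surj T" and nrm: "norm (T x) = norm x" for x
    using T by (auto simp: orthogonal_transformation_linear orthogonal_transformation_surj
        orthogonal_transformation_norm)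
  have Tm [measurable]: "T \<in> borel \<rightarrow>\<^sub>M borel"
    using lin by (simp add: linear_continuous_on linear_conv_bounded_linear borel_measurable_continuous_onI)
  have sgnT: "sgn (T x) = T (sgn x)" for x
    by (simp add: sgn_div_norm nrm linear_cmul[OF lin])
  fix A :: "(real^'n::{finite,wellorder}) set" assume "A \<in> sets (distr uniform_sphere borel T)"
  then have A [measurable]: "A \<in> sets borel" by simp
  let ?B = "ball (0::real^'n::{finite,wellorder}) 1"
  define P where "P = (sgn -` A) \<inter> ?B"
  define Q where "Q = ((\<lambda>x. T (sgn x)) -` A) \<inter> ?B"
  have Pm: "P \<in> sets borel" and Qm: "Q \<in> sets borel"
    unfolding P_def Q_def
    by (intro sets.Int measurable_sets_borel[OF _ A]; simp)+
  have img: "T ` Q = P"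
  proof
    show "T ` Q \<subseteq> P" by (auto simp: P_def Q_def sgnT nrm)
    show "P \<subseteq> T ` Q"
    proof
      fix y assume y: "y \<in> P"
      obtain x where "y = T x" using surj by blast
      then show "y \<in> T ` Q" using y by (auto simp: P_def Q_def sgnT nrm)
    qed
  qed
  have fin: "emeasure lborel S < \<infinity>" if "S \<subseteq> ?B" for S
    using emeasure_mono[OF that, of lborel] emeasure_unit_ball(2)[where 'a = "real^'n::{finite,wellorder}"]
    by (simp add: less_top top.not_eq_extremum)
  have Ql: "Q \<in> lmeasurable"
    using Qm fin[of Q] by (intro fmeasurableI) (auto simp: Q_def)
  have eq: "measure lborel P = measure lborel Q"
    using measure_orthogonal_image[OF T Ql] img Pm Qm by simp
  have "emeasure lborel P = emeasure lborel Q"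
    using eq fin[of P] fin[of Q]
    by (simp add: emeasure_eq_ennreal_measure P_def Q_def less_top)
  then show "emeasure (distr uniform_sphere borel T) A = emeasure uniform_sphere A"
    unfolding uniform_sphere_def
    by (simp add: emeasure_distr distr_distr comp_def P_def Q_def Int_commute
        measurable_sets_borel[OF borel_measurable_sgn A] vimage_def)
qed simp

lemma integrable_cut_value_gw_round:
  fixes U W :: "real^'n::{finite,wellorder}^'n::{finite,wellorder}"
  shows "integrable uniform_sphere (\<lambda>r. cut_value W (gw_round U r))"
proof -
  interpret prob_space "uniform_sphere :: (real^'n::{finite,wellorder}) measure"
    by (rule prob_space_uniform_sphere)
  have "gw_round U r \<in> sign_vectors" for r
    by (simp add: gw_round_def sign_vectors_def)
  then have "range (\<lambda>r. cut_value W (gw_round U r)) \<subseteq> cut_value W ` sign_vectors"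
    by blast
  then have "bounded (range (\<lambda>r. cut_value W (gw_round U r)))"
    by (meson bounded_subset finite_imageI finite_imp_bounded finite_sign_vectors)
  then obtain B where B: "\<And>r. norm (cut_value W (gw_round U r)) \<le> B"
    by (auto simp: bounded_iff)
  have "(\<lambda>r. cut_value W (gw_round U r)) \<in> borel_measurable borel"
    unfolding cut_value_def gw_round_def by simp
  then show ?thesis
    by (intro integrable_const_bound[of _ B]) (use B in auto)
qed

end

(* Relaxing y y^T to Y shows Val(RP) <= <W, 1 - Yhat>/4 for every W, so it suffices to compare
   both sides edge by edge. A random hyperplane separates two unit vectors at angle t with
   probability t/pi: by rotation invariance the probability depends only on t, it is additive in t,
   and antipodal vectors are almost surely separated, so Cauchy's functional equation applies. An
   edge of weight w >= 0 then needs t/pi >= 0.878 (1 - cos t)/2; an edge of weight w < 0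
   contributes -w times the probability of not being separated, which is the same inequality at
   pi - t. *)
theory Submission
  imports Defs
begin

section \<open>Taylor bounds for sine and cosine, and numerical bounds for \<open>pi\<close>\<close>

text \<open>The sine factor in the Lagrange remainder is at most 1, and \<open>x ^ 5\<close> is
  nonnegative. The two cosine bounds below arise in the same way.\<close>

lemma sin_le_Taylor5:
  fixes x :: real
  assumes "0 \<le> x"
  shows "sin x \<le> x - x ^ 3 / 6 + x ^ 5 / 120"
proof -
  obtain t where t: "sin x = (\<Sum>m<5. sin_coeff m * x ^ m)
      + (sin (t + 1/2 * real (5::nat) * pi) / fact 5) * x ^ 5"
    using Maclaurin_sin_expansion[of x 5] by blast
  have "(sin (t + 1/2 * real (5::nat) * pi) / fact 5) * x ^ 5 \<le> (1 / fact 5) * x ^ 5"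
    using assms by (intro mult_right_mono divide_right_mono) auto
  then show ?thesis
    unfolding t by (simp add: sin_coeff_Suc cos_coeff_Suc eval_nat_numeral fact_reduce)
qed

lemma cos_le_Taylor4:
  fixes x :: real
  shows "cos x \<le> 1 - x ^ 2 / 2 + x ^ 4 / 24"
proof -
  obtain t where t: "cos x = (\<Sum>m<4. cos_coeff m * x ^ m)
      + (cos (t + 1/2 * real (4::nat) * pi) / fact 4) * x ^ 4"
    using Maclaurin_cos_expansion[of x 4] by blast
  have "(cos (t + 1/2 * real (4::nat) * pi) / fact 4) * x ^ 4 \<le> (1 / fact 4) * x ^ 4"
    by (intro mult_right_mono divide_right_mono) auto
  then show ?thesis
    unfolding t by (simp add: sin_coeff_Suc cos_coeff_Suc eval_nat_numeral fact_reduce)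
qed

lemma cos_ge_Taylor2:
  fixes x :: real
  shows "1 - x ^ 2 / 2 \<le> cos x"
proof -
  obtain t where t: "cos x = (\<Sum>m<2. cos_coeff m * x ^ m)
      + (cos (t + 1/2 * real (2::nat) * pi) / fact 2) * x ^ 2"
    using Maclaurin_cos_expansion[of x 2] by blast
  have "(- 1 / fact 2) * x ^ 2 \<le> (cos (t + 1/2 * real (2::nat) * pi) / fact 2) * x ^ 2"
    by (intro mult_right_mono divide_right_mono cos_ge_minus_one) auto
  then show ?thesis
    unfolding t by (simp add: sin_coeff_Suc cos_coeff_Suc eval_nat_numeral fact_reduce)
qed

text \<open>If \<open>pi\<close> were smaller, monotonicity of sine would give
  \<open>sin (157 / 300)\<close> at least \<open>sin (pi / 6) = 1 / 2\<close>, where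
  \<open>157 / 300\<close> is \<open>3.14 / 6\<close>; the quintic bound refutes this.\<close>

lemma pi_ge_314: "3.14 \<le> pi"
proof (rule ccontr)
  assume "\<not> 3.14 \<le> pi"
  then have "sin (pi / 6) \<le> sin (157 / 300)"
    using pi_ge_two by (intro sin_monotone_2pi_le) auto
  moreover have "sin (157 / 300 :: real) < 1 / 2"
    by (rule le_less_trans[OF sin_le_Taylor5]) (simp_all add: eval_nat_numeral)
  ultimately show False
    by (simp add: sin_30)
qed

text \<open>If \<open>pi\<close> were larger, 1.6 would lie below \<open>pi / 2\<close> and have a
  positive cosine; the quartic bound is already negative there.\<close>

lemma pi_le_32: "pi \<le> 3.2"
proof (rule ccontr)
  assume "\<not> pi \<le> 3.2"
  then have "0 < cos (1.6 :: real)"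
    by (intro cos_gt_zero) auto
  moreover have "cos (1.6 :: real) < 0"
    by (rule le_less_trans[OF cos_le_Taylor4]) (simp add: eval_nat_numeral)
  ultimately show False by simp
qed

section \<open>The Goemans-Williamson ratio inequality\<close>

lemma gw_ratio_acute:
  fixes t :: real
  assumes "0 \<le> t" "t \<le> pi / 2"
  shows "0.878 * (1 - cos t) \<le> 2 * t / pi"
\<comment> \<open>Below the threshold the quadratic bound suffices, since 0.439 * 1.42 is less than
  2 / 3.2. Above it \<open>cos t\<close> is merely nonnegative, and 0.878 is less than 2 * 1.42 /
  3.2.\<close>
proof (cases "t \<le> 1.42")
  case True
  have "0.878 * (1 - cos t) \<le> 0.439 * t * t"
    using cos_ge_Taylor2[of t] by (simp add: power2_eq_square field_simps)
  also have "\<dots> \<le> 0.439 * t * 1.42"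
    using assms True by (intro mult_left_mono) auto
  also have "\<dots> \<le> 2 * t / 3.2"
    using assms by (simp add: field_simps)
  also have "\<dots> \<le> 2 * t / pi"
    using assms pi_le_32 by (intro divide_left_mono) auto
  finally show ?thesis .
next
  case False
  have "0.878 * (1 - cos t) \<le> 2 * 1.42 / pi"
    proof -
    have "0.878 * (1 - cos t) \<le> 2 * 1.42 / 3.2"
      using cos_ge_zero[of t] assms by auto
    also have "\<dots> \<le> 2 * 1.42 / pi"
      using pi_le_32 by (intro divide_left_mono) auto
    finally show ?thesis .
  qed
  also have "\<dots> \<le> 2 * t / pi"
    using False by (intro divide_right_mono) auto
  finally show ?thesis .
qed

text \<open>Polynomial form of the obtuse case, with \<open>x\<close> standing for
  \<open>pi - t\<close>: the left side bounds \<open>0.878 * cos x\<close>, 1.122 is 2 - 0.878, and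
  0.637 slightly exceeds 2 / 3.14.\<close>

lemma gw_ratio_obtuse_poly:
  fixes x :: real
  assumes "0 \<le> x" "x \<le> 1.6"
  shows "0.878 * (1 - x ^ 2 / 2 + x ^ 4 / 24) \<le> 1.122 - 0.637 * x"
proof -
  \<comment> \<open>0.81 approximates the minimiser of the difference of the two sides.\<close>
  define d D where "d = x - 81 / 100" and "D = d ^ 2"
  have x: "x = 81 / 100 + d" by (simp add: d_def)
  \<comment> \<open>This factor is the quotient by \<open>d ^ 2\<close> of the remainder of
    \<open>x ^ 4\<close> after its tangent at 0.81. On the interval it is below 36 / 5, so the
    quartic can be replaced by a quadratic in \<open>d\<close>.\<close>
  have "x ^ 2 + 1.62 * x + 3 * 0.81 ^ 2 \<le> 1.6 ^ 2 + 1.62 * 1.6 + 3 * 0.81 ^ 2"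
    using assms by (intro add_mono power_mono mult_left_mono) auto
  then have "D * (x ^ 2 + 1.62 * x + 3 * 0.81 ^ 2) \<le> D * (36 / 5)"
    unfolding D_def by (intro mult_left_mono) (auto simp: power2_eq_square)
  moreover have "x ^ 4 = 43046721 / 100000000 + 531441 / 250000 * d + D * (x ^ 2 + 1.62 * x + 3 * 0.81 ^ 2)"
    unfolding x D_def by (simp add: eval_nat_numeral field_simps)
  ultimately have x4: "x ^ 4 \<le> 43046721 / 100000000 + 531441 / 250000 * d + 36 / 5 * D"
    by linarith
  have x2: "x ^ 2 = 6561 / 10000 + 81 / 50 * d + D"
    unfolding x D_def by (simp add: eval_nat_numeral algebra_simps)
  \<comment> \<open>The difference of the two sides is then at least a nonnegative combination of
    these two squares plus a positive constant.\<close>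
  have "0 \<le> (d - 1/50) ^ 2" "0 \<le> d ^ 2" by auto
  then have "0 \<le> D - d / 25 + 1 / 2500" "0 \<le> D"
    by (simp_all add: D_def power2_eq_square algebra_simps)
  then have "878 * (24 - 12 * x ^ 2 + x ^ 4) \<le> 24 * (1122 - 637 * x)"
    using x4 x2 x by argo
  then show ?thesis by (simp add: field_simps)
qed

text \<open>The best constant is about 0.87857, attained near \<open>pi - t = 0.81\<close>, so only
  the obtuse case is tight; there the reflection \<open>x = pi - t\<close> brings the argument into
  the range where the quartic bound for cosine is accurate.\<close>

lemma gw_ratio:
  fixes t :: real
  assumes "0 \<le> t" "t \<le> pi"
  shows "0.878 * ((1 - cos t) / 2) \<le> t / pi"
proof (cases "t \<le> pi / 2")
  case True
  then have "0.878 * (1 - cos t) \<le> 2 * (t / pi)"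
    using gw_ratio_acute[of t] assms by simp
  then show ?thesis by (simp add: field_simps)
next
  case False
  define x where "x = pi - t"
  have x: "0 \<le> x" "x \<le> 1.6"
    using False assms pi_le_32 by (auto simp: x_def)
  have "0.878 * cos x \<le> 0.878 * (1 - x ^ 2 / 2 + x ^ 4 / 24)"
    by (intro mult_left_mono cos_le_Taylor4) simp
  also have "\<dots> \<le> 1.122 - 0.637 * x"
    by (rule gw_ratio_obtuse_poly[OF x])
  also have "\<dots> \<le> 1.122 - 2 * x / pi"
  proof -
    have "2 * x / pi \<le> 2 * x / 3.14"
      using x pi_ge_314 by (intro divide_left_mono) auto
    then show ?thesis using x by (simp add: field_simps)
  qed
  finally show ?thesis
    by (simp add: x_def field_simps)
qed

section \<open>Cauchy's functional equation on an interval\<close>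

text \<open>Nonnegativity takes the place of continuity: it makes \<open>f\<close> monotone on the
  interval. Additivity fixes \<open>f\<close> on the grid of mesh \<open>a / n\<close>, and rounding
  down to the grid loses at most \<open>1 / n\<close>.\<close>

lemma additive_interval_linear:
  fixes f :: "real \<Rightarrow> real"
  assumes a: "0 < a" and nonneg: "\<And>t. 0 \<le> f t"
    and add: "\<And>s t. 0 \<le> s \<Longrightarrow> 0 \<le> t \<Longrightarrow> s + t \<le> a \<Longrightarrow> f (s + t) = f s + f t"
    and top: "f a = 1" and t: "0 \<le> t" "t \<le> a"
  shows "f t = t / a"
proof -
  have f0: "f 0 = 0" using add[of 0 0] a by simp
  have mult: "f (real k * x) = real k * f x" if "0 \<le> x" "real k * x \<le> a" for k x
    using that(2)
  proof (induction k)
    case 0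
    show ?case by (simp add: f0)
  next
    case (Suc k)
    have "real k * x \<le> real (Suc k) * x" using that by (intro mult_right_mono) auto
    with Suc.IH Suc.prems have "f (real k * x) = real k * f x" by linarith
    with add[of "real k * x" x] Suc.prems that show ?case
      by (simp add: algebra_simps)
  qed
  have lower: "s / a \<le> f s" if s: "0 \<le> s" "s \<le> a" for s
  proof (rule field_le_epsilon)
    fix e :: real assume "0 < e"
    then obtain m where m: "inverse (real (Suc m)) < e"
      using reals_Archimedean by blast
    define n where "n = Suc m"
    have n: "0 < real n" "1 / real n < e" using m by (auto simp: n_def inverse_eq_divide)
    define h where "h = a / n"
    have h: "0 < h" using a n by (simp add: h_def)
    have fh: "f h = 1 / n"
      using mult[of h n] top h n by (simp add: h_def field_simps)
    define k where "k = nat \<lfloor>s / h\<rfloor>"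
    have k: "real k \<le> s / h" "s / h \<le> real k + 1"
      using s h by (auto simp: k_def)
    have kh: "real k * h \<le> s" using k(1) h by (simp add: field_simps)
    have "f s = f (real k * h) + f (s - real k * h)"
      using add[of "real k * h" "s - real k * h"] kh h s by simp
    then have "real k * (1 / n) \<le> f s"
      using nonneg mult[of h k] kh h s fh by (smt (verit) less_imp_le)
    moreover have "s / a \<le> real k * (1 / n) + 1 / n"
    proof -
      have "s / a = (s / h) * (1 / n)"
        using a n by (simp add: h_def)
      also have "\<dots> \<le> (real k + 1) * (1 / n)"
        using k n by (intro mult_right_mono) auto
      finally show ?thesis by (simp add: add_divide_distrib)
    qed
    ultimately show "s / a \<le> f s + e"
      using n(2) by linarith
  qed
  \<comment> \<open>The upper bound at \<open>t\<close> comes from the lower bound at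
    \<open>a - t\<close>, because both pairs of values sum to 1.\<close>
  have "f t + f (a - t) = 1"
    using add[of t "a - t"] t top by simp
  moreover have "(a - t) / a = 1 - t / a" using a by (simp add: field_simps)
  ultimately show ?thesis
    using lower[OF t] lower[of "a - t"] t by linarith
qed

section \<open>Separation of two vectors by a random hyperplane\<close>

text \<open>Ties count as nonnegative, exactly as in \<open>gw_round\<close>, so this is the event
  that rounding separates the two vectors for every \<open>r\<close>, with no exceptional null
  set.\<close>

definition sign_disagree :: "'a::real_inner \<Rightarrow> 'a \<Rightarrow> 'a set" where
  "sign_disagree u v = {r. (0 \<le> u \<bullet> r) \<noteq> (0 \<le> v \<bullet> r)}"

lemma sign_disagree_sets [measurable]:
  "sign_disagree u (v :: 'a::euclidean_space) \<in> sets borel"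
  unfolding sign_disagree_def by measurable

lemma space_uniform_sphere [simp]: "space uniform_sphere = UNIV"
  by (simp add: uniform_sphere_def)

text \<open>A hyperplane through the origin is Lebesgue-null, and radial projection moves no point
  into it.\<close>

lemma AE_uniform_sphere_hyperplane:
  fixes u :: "'a::euclidean_space"
  assumes "u \<noteq> 0"
  shows "AE r in uniform_sphere. u \<bullet> r \<noteq> 0"
proof -
  have m: "sgn \<in> uniform_measure lborel (ball (0::'a) 1) \<rightarrow>\<^sub>M borel" by simp
  have "negligible {x. u \<bullet> x = 0}"
    using assms by (intro negligible_hyperplane) auto
  then have "AE x in lebesgue. x \<notin> {x. u \<bullet> x = 0}"
    by (intro AE_not_in) (simp add: negligible_iff_null_sets)
  then have "AE x in lborel. u \<bullet> x \<noteq> 0"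
    by (simp add: AE_completion_iff)
  then have "AE x in lborel. x \<in> ball 0 1 \<longrightarrow> u \<bullet> sgn x \<noteq> 0"
    by eventually_elim (auto simp: sgn_div_norm)
  then have "AE x in uniform_measure lborel (ball (0::'a) 1). u \<bullet> sgn x \<noteq> 0"
    by (intro AE_uniform_measureI) auto
  then show ?thesis
    unfolding uniform_sphere_def by (subst AE_distr_iff[OF m]) auto
qed

lemma measure_sign_disagree_orthogonal:
  fixes T :: "real^'n::{finite,wellorder} \<Rightarrow> real^'n::{finite,wellorder}"
  assumes T: "orthogonal_transformation T"
  shows "measure uniform_sphere (sign_disagree (T u) (T v)) = measure uniform_sphere (sign_disagree u v)"
proof -
  have [measurable]: "T \<in> borel \<rightarrow>\<^sub>M borel"
    using T by (simp add: orthogonal_transformation_linear linear_continuous_on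
        linear_conv_bounded_linear[symmetric] borel_measurable_continuous_onI)
  have "measure uniform_sphere (sign_disagree (T u) (T v))
      = measure (distr uniform_sphere borel T) (sign_disagree (T u) (T v))"
    by (simp add: distr_orthogonal_uniform_sphere[OF T])
  also have "\<dots> = measure uniform_sphere (T -` sign_disagree (T u) (T v))"
    by (subst measure_distr) auto
  also have "T -` sign_disagree (T u) (T v) = sign_disagree u v"
    using T by (auto simp: sign_disagree_def orthogonal_transformation_def)
  finally show ?thesis .
qed

text \<open>Off the null hyperplane orthogonal to \<open>u\<close>, the signs of \<open>u\<close>
  and \<open>- u\<close> are opposite, so the two events are complementary. On that hyperplane both
  vectors count as nonnegative.\<close>

lemma measure_sign_disagree_uminus:
  fixes u v :: "'a::euclidean_space"
  assumes "u \<noteq> 0"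
  shows "measure uniform_sphere (sign_disagree v (- u)) = 1 - measure uniform_sphere (sign_disagree u v)"
proof -
  interpret prob_space "uniform_sphere :: 'a measure"
    by (rule prob_space_uniform_sphere)
  have "measure uniform_sphere (sign_disagree v (- u)) = measure uniform_sphere (space uniform_sphere - sign_disagree u v)"
  proof (rule finite_measure_eq_AE)
    show "AE r in uniform_sphere. (r \<in> sign_disagree v (- u)) = (r \<in> space uniform_sphere - sign_disagree u v)"
      using AE_uniform_sphere_hyperplane[OF assms]
      by eventually_elim (auto simp: sign_disagree_def)
  qed auto
  also have "\<dots> = 1 - measure uniform_sphere (sign_disagree u v)"
    by (intro prob_compl) simp
  finally show ?thesis .
qed

section \<open>Rotations in a plane and additivity in the angle\<close>

text \<open>For orthonormal \<open>u\<close> and \<open>e\<close> this runs through the unit circle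
  of their plane, with \<open>t\<close> the angle from \<open>u\<close>.\<close>

definition circle_point :: "'a::real_vector \<Rightarrow> 'a \<Rightarrow> real \<Rightarrow> 'a" where
  "circle_point u e t = cos t *\<^sub>R u + sin t *\<^sub>R e"

lemma plane_rotation_exists:
  fixes u e :: "'a::euclidean_space"
  assumes u: "u \<bullet> u = 1" and e: "e \<bullet> e = 1" and ue: "u \<bullet> e = 0"
  obtains T where "orthogonal_transformation T"
    "\<And>t. T (circle_point u e t) = circle_point u e (s + t)"
proof
  \<comment> \<open>\<open>a x\<close> and \<open>b x\<close> are the coordinates of the
    displacement of \<open>x\<close> when its component in the plane is rotated by \<open>s\<close>;
    the orthogonal complement stays fixed.\<close>
  define a b where "a x = (x \<bullet> u) * (cos s - 1) - (x \<bullet> e) * sin s"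
    and "b x = (x \<bullet> u) * sin s + (x \<bullet> e) * (cos s - 1)" for x
  define T where "T x = x + a x *\<^sub>R u + b x *\<^sub>R e" for x
  have eu: "e \<bullet> u = 0" using ue by (simp add: inner_commute)
  have "linear T"
    by (rule linearI) (simp_all add: T_def a_def b_def algebra_simps inner_simps)
  moreover have "T v \<bullet> T w = v \<bullet> w" for v w
  proof -
    \<comment> \<open>The change in the inner product carries the factor
      \<open>c\<^sup>2 + d\<^sup>2 - 1\<close>, which vanishes for \<open>c = cos s\<close> and
      \<open>d = sin s\<close>.\<close>
    have ring: "(p' * (c - 1) - q' * d) * p + (p' * d + q' * (c - 1)) * q
        + (p * (c - 1) - q * d) * p' + (p * d + q * (c - 1)) * q'
        + (p * (c - 1) - q * d) * (p' * (c - 1) - q' * d)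
        + (p * d + q * (c - 1)) * (p' * d + q' * (c - 1))
      = (c\<^sup>2 + d\<^sup>2 - 1) * (p * p' + q * q')" for c d p q p' q' :: real
      by (simp add: power2_eq_square algebra_simps)
    have "a w * (v \<bullet> u) + b w * (v \<bullet> e) + a v * (w \<bullet> u) + b v * (w \<bullet> e)
        + a v * a w + b v * b w = 0"
      unfolding a_def b_def ring by simp
    then show ?thesis
      by (simp add: T_def inner_add u e ue eu inner_commute[of u w] inner_commute[of e w]
          algebra_simps)
  qed
  ultimately show "orthogonal_transformation T"
    by (simp add: orthogonal_transformation_def)
  show "T (circle_point u e t) = circle_point u e (s + t)" for t
    by (simp add: T_def a_def b_def circle_point_def inner_simps u e ue eu cos_add sin_add
        algebra_simps)
qed

text \<open>The middle vector \<open>p s\<close> is a nonnegative combination of \<open>p 0\<close> and \<open>p (s + t)\<close>, so it cannot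
  disagree with both.\<close>

lemma sign_disagree_circle_point_Un:
  fixes u e :: "'a::real_inner"
  assumes st: "0 \<le> s" "0 \<le> t" "s + t < pi"
  defines "p \<equiv> circle_point u e"
  shows "sign_disagree (p 0) (p (s + t)) = sign_disagree (p 0) (p s) \<union> sign_disagree (p s) (p (s + t))"
    and "sign_disagree (p 0) (p s) \<inter> sign_disagree (p s) (p (s + t)) = {}"
proof -
  have key: "(0 \<le> p s \<bullet> r) = (0 \<le> p 0 \<bullet> r)" if eq: "(0 \<le> p 0 \<bullet> r) = (0 \<le> p (s + t) \<bullet> r)" for r
  proof (cases "s + t = 0")
    case True
    then have "s = 0" using st by simp
    then show ?thesis by simp
  next
    case False
    then have pos: "0 < sin (s + t)" using st by (intro sin_gt_zero) auto
    have nn: "0 \<le> sin t" "0 \<le> sin s" using st by (auto intro!: sin_ge_zero)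
    \<comment> \<open>One coefficient of the combination must be strictly positive: when both outer
      vectors have negative inner product with \<open>r\<close>, the middle one has to be strictly
      negative as well.\<close>
    have ne: "0 < sin s \<or> 0 < sin t"
      using pos nn by (auto simp: sin_add less_le)
    have c: "sin (s + t) * cos s = sin t + sin s * cos (s + t)"
      using sin_diff[of "s + t" s] by (simp add: algebra_simps)
    have comb: "sin (s + t) *\<^sub>R p s = sin t *\<^sub>R p 0 + sin s *\<^sub>R p (s + t)"
    proof -
      have "sin (s + t) *\<^sub>R p s = (sin (s + t) * cos s) *\<^sub>R u + (sin (s + t) * sin s) *\<^sub>R e"
        by (simp add: p_def circle_point_def scaleR_add_right)
      then show ?thesis
        unfolding c
        by (simp add: p_def circle_point_def scaleR_add_right scaleR_add_left mult.commute)
    qed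
    have eq2: "sin (s + t) * (p s \<bullet> r) = sin t * (p 0 \<bullet> r) + sin s * (p (s + t) \<bullet> r)"
      using arg_cong[OF comb, of "\<lambda>x. x \<bullet> r"] by (simp add: inner_simps)
    show ?thesis
    proof (cases "0 \<le> p 0 \<bullet> r")
      case True
      then have "0 \<le> sin (s + t) * (p s \<bullet> r)"
        unfolding eq2 using nn eq by simp
      then show ?thesis using True pos by (simp add: zero_le_mult_iff)
    next
      case False
      then have "sin t * (p 0 \<bullet> r) \<le> 0" "sin s * (p (s + t) \<bullet> r) \<le> 0"
        "sin t * (p 0 \<bullet> r) < 0 \<or> sin s * (p (s + t) \<bullet> r) < 0"
        using nn ne eq by (auto simp: mult_le_0_iff mult_less_0_iff)
      then have "sin (s + t) * (p s \<bullet> r) < 0"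
        unfolding eq2 by linarith
      then show ?thesis using False pos by (simp add: mult_less_0_iff)
    qed
  qed
  show "sign_disagree (p 0) (p (s + t)) = sign_disagree (p 0) (p s) \<union> sign_disagree (p s) (p (s + t))"
    using key by (auto simp: sign_disagree_def)
  show "sign_disagree (p 0) (p s) \<inter> sign_disagree (p s) (p (s + t)) = {}"
    using key by (auto simp: sign_disagree_def)
qed

lemma measure_sign_disagree_circle_point:
  fixes u e :: "real^'n::{finite,wellorder}"
  assumes u: "u \<bullet> u = 1" and e: "e \<bullet> e = 1" and ue: "u \<bullet> e = 0"
    and t: "0 \<le> t" "t \<le> pi"
  shows "measure uniform_sphere (sign_disagree u (circle_point u e t)) = t / pi"
proof -
  interpret prob_space "uniform_sphere :: (real^'n::{finite,wellorder}) measure"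
    by (rule prob_space_uniform_sphere)
  define p where "p = circle_point u e"
  define f where "f = (\<lambda>t. measure uniform_sphere (sign_disagree (p 0) (p t)))"
  have p0: "p 0 = u" and ppi: "p pi = - u"
    by (simp_all add: p_def circle_point_def)
  have u0: "u \<noteq> 0" using u by auto
  have shift: "measure uniform_sphere (sign_disagree (p s) (p (s + t))) = f t" for s t
  proof -
    obtain T where T: "orthogonal_transformation T" and Tp: "\<And>t. T (p t) = p (s + t)"
      using plane_rotation_exists[OF u e ue] unfolding p_def by metis
    show ?thesis
      using measure_sign_disagree_orthogonal[OF T, of "p 0" "p t"] by (simp add: Tp f_def)
  qed
  have fpi: "f pi = 1"
    using measure_sign_disagree_uminus[OF u0, of u] by (simp add: f_def p0 ppi sign_disagree_def)
  have "f t = t / pi"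
  proof (rule additive_interval_linear[OF pi_gt_zero])
    show "0 \<le> f t" for t
      by (simp add: f_def)
    show "f (s + t) = f s + f t" if "0 \<le> s" "0 \<le> t" "s + t \<le> pi" for s t
    proof (cases "s + t = pi")
      case True
      have "f t = 1 - f s"
        using measure_sign_disagree_uminus[OF u0, of "p s"] shift[of s t] True
        by (simp add: f_def p0 ppi)
      then show ?thesis using True fpi by simp
    next
      case False
      then have "s + t < pi" using that by simp
      note Un = sign_disagree_circle_point_Un[OF that(1,2) this, of u e, folded p_def]
      have "f (s + t) = f s + measure uniform_sphere (sign_disagree (p s) (p (s + t)))"
        unfolding f_def Un(1) by (intro finite_measure_Union Un(2)) auto
      then show ?thesis by (simp add: shift)
    qed
  qed (use fpi t in auto)
  then show ?thesis by (simp add: f_def p0) (simp add: p_def)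
qed

text \<open>Gram-Schmidt places \<open>v\<close> on the circle through \<open>u\<close> at angle
  \<open>arccos (u \<bullet> v)\<close>. If the sine of that angle is 0, then \<open>v\<close> is
  \<open>u\<close> or \<open>- u\<close> and is treated directly.\<close>

lemma measure_sign_disagree:
  fixes u v :: "real^'n::{finite,wellorder}"
  assumes u: "norm u = 1" and v: "norm v = 1"
  shows "measure uniform_sphere (sign_disagree u v) = arccos (u \<bullet> v) / pi"
proof -
  define c where "c = u \<bullet> v"
  have uu: "u \<bullet> u = 1" and vv: "v \<bullet> v = 1"
    using u v by (simp_all add: norm_eq_1)
  have c: "-1 \<le> c" "c \<le> 1"
    using Cauchy_Schwarz_ineq2[of u v] u v by (auto simp: c_def)
  define s where "s = sin (arccos c)"
  have s2: "s\<^sup>2 = 1 - c\<^sup>2"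
    using c by (simp add: s_def sin_squared_eq)
  show ?thesis
  proof (cases "s = 0")
    case True
    then have "c = 1 \<or> c = -1" using s2 by (simp add: power2_eq_1_iff)
    then show ?thesis
    proof
      assume c1: "c = 1"
      then have "(u - v) \<bullet> (u - v) = 0"
        using uu vv by (simp add: c_def inner_diff inner_commute)
      then show ?thesis using c1 by (simp add: c_def sign_disagree_def)
    next
      assume c1: "c = -1"
      then have "(u + v) \<bullet> (u + v) = 0"
        using uu vv by (simp add: c_def inner_add inner_commute)
      then have "v = - u" by (simp add: minus_unique)
      moreover have "u \<noteq> 0" using u by auto
      ultimately show ?thesis
        using c1 measure_sign_disagree_uminus[of u u] by (simp add: c_def sign_disagree_def)
    qed
  next
    case False
    define e where "e = (1 / s) *\<^sub>R (v - c *\<^sub>R u)"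
    have ue: "u \<bullet> e = 0"
      using uu by (simp add: e_def inner_diff_right c_def)
    have "(v - c *\<^sub>R u) \<bullet> (v - c *\<^sub>R u) = 1 - c * c"
      using uu vv by (simp add: inner_diff inner_commute c_def)
    also have "\<dots> = s * s"
      using s2 by (simp add: power2_eq_square)
    finally have ee: "e \<bullet> e = 1"
      using False by (simp add: e_def)
    have "circle_point u e (arccos c) = v"
      using c False by (simp add: circle_point_def e_def s_def)
    then show ?thesis
      using measure_sign_disagree_circle_point[OF uu ee ue, of "arccos c"] c
      by (simp add: arccos_bounded c_def)
  qed
qed

section \<open>The semidefinite relaxation\<close>

lemma sum_off_diagonal_symmetric:
  fixes g :: "'i::{finite,linorder} \<Rightarrow> 'i \<Rightarrow> 'b::comm_semiring_1"
  assumes sym: "\<And>i j. g i j = g j i" and diag: "\<And>i. g i i = 0"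
  shows "(\<Sum>i\<in>UNIV. \<Sum>j\<in>UNIV. g i j) = 2 * (\<Sum>i\<in>UNIV. \<Sum>j | i < j. g i j)"
proof -
  have "(\<Sum>j\<in>UNIV. g i j) = (\<Sum>j | i < j. g i j) + (\<Sum>j | j < i. g i j)" for i
  proof -
    have "(\<Sum>j\<in>UNIV. g i j) = (\<Sum>j\<in>{j. i < j} \<union> {j. j < i}. g i j)"
      by (rule sum.mono_neutral_right) (auto simp: diag not_less_iff_gr_or_eq)
    also have "\<dots> = (\<Sum>j | i < j. g i j) + (\<Sum>j | j < i. g i j)"
      by (rule sum.union_disjoint) auto
    finally show ?thesis .
  qed
  moreover have "(\<Sum>i\<in>UNIV. \<Sum>j | j < i. g i j) = (\<Sum>i\<in>UNIV. \<Sum>j | i < j. g i j)"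
    using sum.swap_restrict[of UNIV UNIV g "\<lambda>i j. j < i"] by (simp add: sym)
  ultimately show ?thesis
    by (simp add: sum.distrib mult_2)
qed

text \<open>The unit diagonal of \<open>Y\<close> cancels the diagonal terms, and symmetry counts
  each remaining pair twice, which turns 1/4 into 1/2.\<close>

lemma sdp_objective_symmetric:
  fixes W Y :: "real^'n::{finite,wellorder}^'n::{finite,wellorder}"
  assumes "transpose W = W" "transpose Y = Y" "\<And>i. Y $ i $ i = 1"
  shows "sdp_objective W Y = (\<Sum>i\<in>UNIV. \<Sum>j | i < j. W $ i $ j * ((1 - Y $ i $ j) / 2))"
proof -
  have "W $ i $ j = W $ j $ i" "Y $ i $ j = Y $ j $ i" for i j
    using assms(1,2) by (metis transpose_def vec_lambda_beta)+
  then have "(\<Sum>i\<in>UNIV. \<Sum>j\<in>UNIV. W $ i $ j * ((1 - Y $ i $ j) / 2))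
      = 2 * (\<Sum>i\<in>UNIV. \<Sum>j | i < j. W $ i $ j * ((1 - Y $ i $ j) / 2))"
    using assms(3) by (intro sum_off_diagonal_symmetric) auto
  then show ?thesis
    by (simp add: sdp_objective_def inner_vec_def sum_divide_distrib[symmetric])
qed

lemma sdp_feasible_outer_product:
  assumes "y \<in> sign_vectors"
  shows "sdp_feasible (\<chi> i j. y $ i * y $ j)"
proof -
  have "x \<bullet> ((\<chi> i j. y $ i * y $ j) *v x) = (y \<bullet> x)\<^sup>2" for x
    by (simp add: inner_vec_def matrix_vector_mult_def power2_eq_square sum_product
        sum_distrib_left mult_ac)
  moreover have "y $ i * y $ i = 1" for i
    using assms by (auto simp: sign_vectors_def) (metis mult_1 mult_minus1 minus_minus)
  ultimately show ?thesis
    by (simp add: sdp_feasible_def pos_semidef_def transpose_def mult.commute)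
qed

text \<open>Each sign vector yields a feasible rank-one matrix with the same inner minimum up to
  scaling; optimality of \<open>Yhat\<close> bounds that minimum, and an infimum is at most the
  value at \<open>W\<close>.\<close>

lemma rp_val_le_sdp_objective:
  fixes \<W> :: "(real^'n::{finite,wellorder}^'n::{finite,wellorder}) set"
  assumes symmetric: "\<And>W. W \<in> \<W> \<Longrightarrow> transpose W = W"
    and sdp_attained: "\<And>Y. sdp_feasible Y \<Longrightarrow> inner_min_attained (\<lambda>W. sdp_objective W Y) \<W>"
    and optimal: "is_arg_max (\<lambda>Y. INF W\<in>\<W>. sdp_objective W Y) sdp_feasible Yhat"
    and W: "W \<in> \<W>"
  shows "rp_val \<W> \<le> sdp_objective W Yhat"
proof -
  \<comment> \<open>The real-valued \<open>INF\<close> is a lower bound only for sets bounded below,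
    which attainment provides.\<close>
  have bdd: "bdd_below ((\<lambda>W. sdp_objective W Y) ` \<W>)" if "sdp_feasible Y" for Y
    using sdp_attained[OF that]
    by (fastforce simp: inner_min_attained_def is_arg_min_linorder bdd_below_def)
  have le: "(INF W\<in>\<W>. rp_objective W y) \<le> 2 * sdp_objective W Yhat" if y: "y \<in> sign_vectors" for y
  proof -
    let ?Y = "\<chi> i j. y $ i * y $ j"
    have feas: "sdp_feasible ?Y" by (rule sdp_feasible_outer_product[OF y])
    \<comment> \<open>The factor 2 is the one that the 1/2 in \<open>rp_val\<close> cancels.\<close>
    have eq: "rp_objective V y = 2 * sdp_objective V ?Y" if "V \<in> \<W>" for V
      using feas by (subst sdp_objective_symmetric[OF symmetric[OF that]])
        (auto simp: sdp_feasible_def pos_semidef_def rp_objective_def sum_distrib_left)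
    obtain V where V: "is_arg_min (\<lambda>W. sdp_objective W ?Y) (\<lambda>W. W \<in> \<W>) V"
      using sdp_attained[OF feas] by (auto simp: inner_min_attained_def)
    have "is_arg_min (\<lambda>W. rp_objective W y) (\<lambda>W. W \<in> \<W>) V"
      using V eq by (auto simp: is_arg_min_linorder)
    then have "(INF W\<in>\<W>. rp_objective W y) = rp_objective V y"
      by (rule INF_eq_attained_min)
    also have "\<dots> = 2 * (INF W\<in>\<W>. sdp_objective W ?Y)"
      using V eq INF_eq_attained_min[OF V] by (simp add: is_arg_min_linorder)
    also have "\<dots> \<le> 2 * (INF W\<in>\<W>. sdp_objective W Yhat)"
      using optimal feas by (auto simp: is_arg_max_linorder)
    also have "\<dots> \<le> 2 * sdp_objective W Yhat"
      using optimal W by (auto simp: is_arg_max_linorder intro!: cINF_lower bdd)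
    finally show ?thesis .
  qed
  \<comment> \<open>\<open>Max_le_iff\<close> needs a nonempty set.\<close>
  have "(\<chi> i. 1) \<in> (sign_vectors :: (real^'n::{finite,wellorder}) set)"
    by (simp add: sign_vectors_def)
  then have "(MAX y\<in>sign_vectors. INF W\<in>\<W>. rp_objective W y) \<le> 2 * sdp_objective W Yhat"
    using finite_sign_vectors le by (subst Max_le_iff) auto
  then show ?thesis by (simp add: rp_val_def)
qed

section \<open>Expected cut and comparison edge by edge\<close>

lemma expected_cut_value:
  fixes U W :: "real^'n::{finite,wellorder}^'n::{finite,wellorder}"
  assumes unit: "\<And>i. norm (column i U) = 1"
  shows "(LINT r|uniform_sphere. cut_value W (gw_round U r))
    = (\<Sum>i\<in>UNIV. \<Sum>j | i < j. W $ i $ j * (arccos (column i U \<bullet> column j U) / pi))"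
proof -
  interpret prob_space "uniform_sphere :: (real^'n::{finite,wellorder}) measure"
    by (rule prob_space_uniform_sphere)
  have "cut_value W (gw_round U r)
      = (\<Sum>i\<in>UNIV. \<Sum>j | i < j. W $ i $ j * indicator (sign_disagree (column i U) (column j U)) r)" for r
    unfolding cut_value_def gw_round_def
    by (intro sum.cong refl) (auto simp: sign_disagree_def indicator_def)
  then have "(LINT r|uniform_sphere. cut_value W (gw_round U r))
      = (LINT r|uniform_sphere. (\<Sum>i\<in>UNIV. \<Sum>j | i < j.
          W $ i $ j * indicator (sign_disagree (column i U) (column j U)) r))"
    by presburger
  also have "\<dots> = (\<Sum>i\<in>UNIV. \<Sum>j | i < j. (LINT r|uniform_sphere.
      W $ i $ j * indicator (sign_disagree (column i U) (column j U)) r))"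
    by (subst Bochner_Integration.integral_sum;
        (intro sum.cong refl Bochner_Integration.integral_sum)?;
        intro Bochner_Integration.integrable_sum integrable_mult_right integrable_real_indicator)
      (auto simp: emeasure_eq_measure)
  also have "\<dots> = (\<Sum>i\<in>UNIV. \<Sum>j | i < j. W $ i $ j * (arccos (column i U \<bullet> column j U) / pi))"
    by (simp add: measure_sign_disagree[OF unit unit])
  finally show ?thesis .
qed

text \<open>For negative \<open>w\<close>, subtracting \<open>w\<close> leaves \<open>- w\<close>
  times \<open>(1 + c) / 2\<close> on the left and \<open>- w\<close> times
  \<open>1 - arccos c / pi\<close> on the right; this is the unweighted inequality at
  \<open>arccos (- c) = pi - arccos c\<close>.\<close>

lemma gw_ratio_weighted:
  fixes w c :: real
  assumes "-1 \<le> c" "c \<le> 1"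
  shows "0.878 * (w * ((1 - c) / 2) - min w 0) \<le> w * (arccos c / pi) - min w 0"
proof (cases "0 \<le> w")
  case True
  have "0.878 * ((1 - c) / 2) \<le> arccos c / pi"
    using gw_ratio[of "arccos c"] assms by (simp add: arccos_bounded)
  then have "w * (0.878 * ((1 - c) / 2)) \<le> w * (arccos c / pi)"
    using True by (rule mult_left_mono)
  then show ?thesis using True by (simp add: algebra_simps)
next
  case False
  have "arccos (- c) / pi = 1 - arccos c / pi"
    using assms by (simp add: arccos_minus diff_divide_distrib)
  then have "0.878 * ((1 + c) / 2) \<le> 1 - arccos c / pi"
    using gw_ratio[of "arccos (- c)"] assms by (simp add: arccos_bounded)
  then have "(- w) * (0.878 * ((1 + c) / 2)) \<le> (- w) * (1 - arccos c / pi)"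
    using False by (intro mult_left_mono) auto
  then show ?thesis using False by (simp add: algebra_simps add_divide_distrib diff_divide_distrib)
qed

theorem theoremB1:
  fixes \<W> :: "(real^'n::{finite,wellorder}^'n::{finite,wellorder}) set"
    and Yhat U :: "real^'n::{finite,wellorder}^'n::{finite,wellorder}"
  assumes symmetric: "\<And>W. W \<in> \<W> \<Longrightarrow> transpose W = W"
    and rp_attained: "\<And>y. y \<in> sign_vectors \<Longrightarrow> inner_min_attained (\<lambda>W. rp_objective W y) \<W>"
    and sdp_attained: "\<And>Y. sdp_feasible Y \<Longrightarrow> inner_min_attained (\<lambda>W. sdp_objective W Y) \<W>"
    and optimal: "is_arg_max (\<lambda>Y. INF W\<in>\<W>. sdp_objective W Y) sdp_feasible Yhat"
    and factor: "Yhat = transpose U ** U"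
  shows "\<forall>W\<in>\<W>. (LINT r|uniform_sphere. cut_value W (gw_round U r)) - neg_weight W
           \<ge> 0.878 * (rp_val \<W> - neg_weight W)"
proof
  fix W assume W: "W \<in> \<W>"
  have feas: "sdp_feasible Yhat" using optimal by (simp add: is_arg_max_linorder)
  have gram: "Yhat $ i $ j = column i U \<bullet> column j U" for i j
    by (simp add: factor matrix_matrix_mult_def transpose_def column_def inner_vec_def)
  have unit: "norm (column i U) = 1" for i
    using feas gram[of i i] by (simp add: sdp_feasible_def norm_eq_1)
  have bound: "-1 \<le> column i U \<bullet> column j U \<and> column i U \<bullet> column j U \<le> 1" for i j
    using Cauchy_Schwarz_ineq2[of "column i U" "column j U"] unit by (auto simp: abs_le_iff)
  \<comment> \<open>With \<open>min\<close> the sum runs over all pairs, so that it can be merged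
    termwise with the other two sums.\<close>
  have neg: "neg_weight W = (\<Sum>i\<in>UNIV. \<Sum>j | i < j. min (W $ i $ j) 0)"
    unfolding neg_weight_def
    by (intro sum.cong refl sum.mono_neutral_cong_left) (auto simp: min_def)
  have sdp: "sdp_objective W Yhat
      = (\<Sum>i\<in>UNIV. \<Sum>j | i < j. W $ i $ j * ((1 - column i U \<bullet> column j U) / 2))"
    using feas by (subst sdp_objective_symmetric[OF symmetric[OF W]])
      (auto simp: sdp_feasible_def pos_semidef_def gram)
  have "0.878 * (rp_val \<W> - neg_weight W) \<le> 0.878 * (sdp_objective W Yhat - neg_weight W)"
    using rp_val_le_sdp_objective[OF symmetric sdp_attained optimal W]
    by (intro mult_left_mono diff_right_mono) auto
  also have "\<dots> = (\<Sum>i\<in>UNIV. \<Sum>j | i < j.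
      0.878 * (W $ i $ j * ((1 - column i U \<bullet> column j U) / 2) - min (W $ i $ j) 0))"
    unfolding sdp neg by (simp only: sum_distrib_left[symmetric] sum_subtractf)
  also have "\<dots> \<le> (\<Sum>i\<in>UNIV. \<Sum>j | i < j.
      W $ i $ j * (arccos (column i U \<bullet> column j U) / pi) - min (W $ i $ j) 0)"
    using bound by (intro sum_mono gw_ratio_weighted) auto
  also have "\<dots> = (LINT r|uniform_sphere. cut_value W (gw_round U r)) - neg_weight W"
    unfolding expected_cut_value[OF unit] neg by (simp only: sum_subtractf)
  finally show "0.878 * (rp_val \<W> - neg_weight W)
      \<le> (LINT r|uniform_sphere. cut_value W (gw_round U r)) - neg_weight W" .
qed

end
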